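(* Let the data $(A_0,A_1,b_0,b_1,c_0,c_1)$ and parameters $(\xi,\zeta,\hat\gamma)$, $\hat\gamma\ge0$, and $\epsilon\in(0,1)$ satisfy: for both $i\in\{0,1\}$, $A_i$ has at least one negative eigenvalue and $\|A_i\|,\|b_i\|,|c_i|\le1$; $\gamma_+\le\zeta$; $A(\hat\gamma)\succeq\xi I$; and $0<\xi\le1\le\zeta$. Suppose that $$\delta:=\left\|A_0A(\hat\gamma)^{-1}b_1-A_1A(\hat\gamma)^{-1}b_0\right\|>0.$$ Then $\frac{d}{d\gamma}\nu(\gamma)\le-\dfrac{\delta^2\xi^2}{4\zeta^3}$ for any $\gamma\in\mathrm{int}(\Gamma)$. In particular, the set of $\gamma\in\mathrm{int}(\Gamma)$ with $|\nu(\gamma)|\le\epsilon/(2\zeta)$ is an interval of length at most $\dfrac{4\epsilon\zeta^2}{\delta^2\xi^2}$.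
   Context: $A_0,A_1$ are real symmetric $n\times n$ matrices, $b_0,b_1\in\mathbb R^n$, $c_0,c_1\in\mathbb R$, $q_i(x)=x^\top A_ix+2b_i^\top x+c_i$. $\|\cdot\|$ is the spectral norm for matrices and Euclidean norm for vectors. $A(\gamma)=A_0+\gamma A_1$, $b(\gamma)=b_0+\gamma b_1$. $\Gamma=\{\gamma\ge0:A(\gamma)\succeq0\}$ is a closed interval with right endpoint $\gamma_+=\sup\Gamma$. For $\gamma\in\mathrm{int}(\Gamma)$ (where $A(\gamma)\succ0$), $x(\gamma)=-A(\gamma)^{-1}b(\gamma)$ and $\nu(\gamma)=q_1(x(\gamma))$. The interval in the conclusion may be empty. *)

theory Defs
  imports "HOL-Analysis.Analysis"
begin

definition eigenvalue :: "real ^ 'n ^ 'n \<Rightarrow> real \<Rightarrow> bool" where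
  "eigenvalue A l \<longleftrightarrow> (\<exists>v. v \<noteq> 0 \<and> A *v v = l *\<^sub>R v)"

(* The norm of the type real ^ 'n ^ 'n is the Frobenius norm, so the spectral norm
   has to be taken as the operator norm of the associated linear map. *)
definition spectral_norm :: "real ^ 'n ^ 'n \<Rightarrow> real" where
  "spectral_norm A = onorm ((*v) A)"

definition psd :: "real ^ 'n ^ 'n \<Rightarrow> bool" where
  "psd A \<longleftrightarrow> transpose A = A \<and> (\<forall>x. 0 \<le> x \<bullet> (A *v x))"

definition loewner_ge :: "real ^ 'n ^ 'n \<Rightarrow> real ^ 'n ^ 'n \<Rightarrow> bool" where
  "loewner_ge A B \<longleftrightarrow> psd (A - B)"

definition quad :: "real ^ 'n ^ 'n \<Rightarrow> real ^ 'n \<Rightarrow> real \<Rightarrow> real ^ 'n \<Rightarrow> real" where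
  "quad A b c x = x \<bullet> (A *v x) + 2 * (b \<bullet> x) + c"

(* Used both for A(g) = A0 + g A1 and for b(g) = b0 + g b1. *)
definition pencil :: "'a::real_vector \<Rightarrow> 'a \<Rightarrow> real \<Rightarrow> 'a" where
  "pencil u0 u1 g = u0 + g *\<^sub>R u1"

definition Gamma_set :: "real ^ 'n ^ 'n \<Rightarrow> real ^ 'n ^ 'n \<Rightarrow> real set" where
  "Gamma_set A0 A1 = {g. 0 \<le> g \<and> loewner_ge (pencil A0 A1 g) 0}"

(* Sup is the true supremum only if Gamma_set is nonempty and bounded above;
   boundedness holds as soon as A1 has a negative eigenvalue. *)
definition gamma_plus :: "real ^ 'n ^ 'n \<Rightarrow> real ^ 'n ^ 'n \<Rightarrow> real" where
  "gamma_plus A0 A1 = Sup (Gamma_set A0 A1)"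

(* crit_pt and nu are meaningful where pencil A0 A1 g is invertible, in particular on
   interior (Gamma_set A0 A1) whenever some pencil A0 A1 g with g \<ge> 0 is positive definite. *)
definition crit_pt ::
  "real ^ 'n ^ 'n \<Rightarrow> real ^ 'n ^ 'n \<Rightarrow> real ^ 'n \<Rightarrow> real ^ 'n \<Rightarrow> real \<Rightarrow> real ^ 'n" where
  "crit_pt A0 A1 b0 b1 g = - (matrix_inv (pencil A0 A1 g) *v pencil b0 b1 g)"

definition nu ::
  "real ^ 'n ^ 'n \<Rightarrow> real ^ 'n ^ 'n \<Rightarrow> real ^ 'n \<Rightarrow> real ^ 'n \<Rightarrow> real \<Rightarrow> real \<Rightarrow> real" where
  "nu A0 A1 b0 b1 c1 g = quad A1 b1 c1 (crit_pt A0 A1 b0 b1 g)"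

end

theory Submission
  imports Defs
begin

text \<open>
  Write $w = A_1 x(\gamma) + b_1$. Differentiating $A(\gamma)x(\gamma) = -b(\gamma)$ gives
  $\nu'(\gamma) = -2\, w^\top A(\gamma)^{-1} w \le -2\|w\|^2 / \|A(\gamma)\|$, and
  $\|A(\gamma)\| \le 1 + \gamma \le 2\zeta$. For the lower bound on $w$, note that
  $A_0 x(\gamma) + b_0 = -\gamma w$; eliminating $x(\gamma)$ by means of $A(\hat\gamma)^{-1}$ gives
  $A_0 A(\hat\gamma)^{-1} b_1 - A_1 A(\hat\gamma)^{-1} b_0
    = w - (\hat\gamma - \gamma) A_1 A(\hat\gamma)^{-1} w$,
  so $\delta \le (1 + \zeta/\xi)\|w\| \le (2\zeta/\xi)\|w\|$. The length bound is the mean value theorem.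
\<close>

section \<open>Coercive matrices, their inverses, and spectral norm bounds\<close>

text \<open>Coercivity forces a trivial kernel. An explicit constant \<open>\<mu>\<close> stands in
  for positive definiteness throughout, because it also bounds the inverse quantitatively.\<close>

lemma coercive_imp_invertible:
  fixes A :: "real ^ 'n ^ 'n"
  assumes "0 < \<mu>" and "\<And>x. \<mu> * (norm x)\<^sup>2 \<le> x \<bullet> (A *v x)"
  shows "invertible A"
proof -
  have "x = 0" if "A *v x = 0" for x
  proof -
    have "\<mu> * (norm x)\<^sup>2 \<le> 0"
      using assms(2)[of x] that by simp
    with assms(1) show ?thesis
      by (simp add: mult_le_0_iff)
  qed
  then have "\<exists>B. B ** A = mat 1"
    unfolding matrix_left_invertible_ker by blast
  then show ?thesis
    by (simp add: invertible_left_inverse)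
qed

lemma invertible_matrix_inv:
  fixes A :: "'a::semiring_1 ^ 'n ^ 'm"
  assumes "invertible A"
  shows "A ** matrix_inv A = mat 1" and "matrix_inv A ** A = mat 1"
  using someI_ex[OF assms[unfolded invertible_def]] by (auto simp: matrix_inv_def)

lemma matrix_vector_mult_minus:
  fixes A :: "real ^ 'n ^ 'm"
  shows "A *v (- x) = - (A *v x)"
  by (rule linear_neg) (rule matrix_vector_mul_linear)

lemma invertible_mult_inv_vector:
  fixes A :: "real ^ 'n ^ 'n"
  assumes "invertible A"
  shows "A *v (matrix_inv A *v v) = v"
  using invertible_matrix_inv(1)[OF assms] by (simp add: matrix_vector_mul_assoc)

lemma invertible_inv_mult_vector:
  fixes A :: "real ^ 'n ^ 'n"
  assumes "invertible A"
  shows "matrix_inv A *v (A *v v) = v"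
  using invertible_matrix_inv(2)[OF assms] by (simp add: matrix_vector_mul_assoc)

text \<open>With u the image of v under the inverse, coercivity and Cauchy-Schwarz give \<mu> |u|^2
  \<le> u . v \<le> |u| |v|; then |u| cancels.\<close>

lemma norm_coercive_inv_le:
  fixes A :: "real ^ 'n ^ 'n"
  assumes "0 < \<mu>" and "\<And>x. \<mu> * (norm x)\<^sup>2 \<le> x \<bullet> (A *v x)"
  shows "norm (matrix_inv A *v v) \<le> norm v / \<mu>"
proof -
  define u where "u = matrix_inv A *v v"
  have "A *v u = v"
    using invertible_mult_inv_vector[OF coercive_imp_invertible[OF assms]] by (simp add: u_def)
  with assms(2)[of u] have "\<mu> * (norm u)\<^sup>2 \<le> norm u * norm v"
    using norm_cauchy_schwarz[of u v] by simp
  then have "norm u * (\<mu> * norm u) \<le> norm u * norm v"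
    by (simp add: power2_eq_square mult_ac)
  then have "\<mu> * norm u \<le> norm v"
    by (cases "norm u = 0") (auto simp: mult_le_cancel_left)
  then show ?thesis
    using assms(1) by (simp add: u_def field_simps)
qed

text \<open>For an invertible A and u the solution of A u = w, this becomes |w|^2 \<le> L (w . u),
  the lower bound on the quadratic form of the inverse, obtained without diagonalisation or square
  roots.\<close>

lemma psd_norm_square_le:
  fixes A :: "real ^ 'n ^ 'n"
  assumes "psd A" and "0 < L" and "\<And>x. x \<bullet> (A *v x) \<le> L * (norm x)\<^sup>2"
  shows "(norm (A *v u))\<^sup>2 \<le> L * (u \<bullet> (A *v u))"
proof -
  define v where "v = A *v u"
  \<comment> \<open>A gradient step of length 1/L for half the form. Nonnegativity of the form at
    \<open>y\<close>, with the cubic term v . A v bounded by L |v|^2, leaves exactly |v|^2 / L \<le>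
    u . v.\<close>
  define y where "y = u - (1 / L) *\<^sub>R v"
  have sym: "transpose A = A" and "0 \<le> y \<bullet> (A *v y)"
    using assms(1) by (auto simp: psd_def)
  have "u \<bullet> (A *v v) = v \<bullet> v"
    using sym by (metis dot_lmul_matrix transpose_matrix_vector v_def)
  moreover have "A *v y = v - (1 / L) *\<^sub>R (A *v v)"
    by (simp add: y_def v_def matrix_vector_mult_diff_distrib matrix_vector_mult_scaleR)
  ultimately have "y \<bullet> (A *v y) = u \<bullet> v - 2 / L * (v \<bullet> v) + (1 / L)\<^sup>2 * (v \<bullet> (A *v v))"
    by (simp add: y_def inner_diff_left inner_diff_right inner_commute power2_eq_square
        right_diff_distrib diff_divide_distrib)
  also have "\<dots> \<le> u \<bullet> v - 2 / L * (v \<bullet> v) + (1 / L)\<^sup>2 * (L * (norm v)\<^sup>2)"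
    using assms(3)[of v] by (intro add_left_mono mult_left_mono) auto
  also have "\<dots> = u \<bullet> v - (norm v)\<^sup>2 / L"
    using assms(2) by (simp add: dot_square_norm power2_eq_square field_simps)
  finally have "0 \<le> u \<bullet> v - (norm v)\<^sup>2 / L"
    using \<open>0 \<le> y \<bullet> (A *v y)\<close> by linarith
  then show ?thesis
    using assms(2) by (simp add: v_def field_simps)
qed

lemma norm_mult_le_spectral_norm:
  fixes A :: "real ^ 'n ^ 'n"
  shows "norm (A *v x) \<le> spectral_norm A * norm x"
  unfolding spectral_norm_def by (rule onorm) (rule matrix_vector_mul_bounded_linear)

lemma abs_quadratic_form_le_spectral_norm:
  fixes A :: "real ^ 'n ^ 'n"
  shows "\<bar>x \<bullet> (A *v x)\<bar> \<le> spectral_norm A * (norm x)\<^sup>2"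
proof -
  have "\<bar>x \<bullet> (A *v x)\<bar> \<le> norm x * norm (A *v x)"
    by (rule Cauchy_Schwarz_ineq2)
  also have "\<dots> \<le> norm x * (spectral_norm A * norm x)"
    by (intro mult_left_mono norm_mult_le_spectral_norm) auto
  finally show ?thesis
    by (simp add: power2_eq_square mult_ac)
qed

section \<open>Perturbation of the pencil and continuity of its inverse\<close>

lemma pencil_mult_vector:
  fixes A0 A1 :: "real ^ 'n ^ 'n"
  shows "pencil A0 A1 g *v x = A0 *v x + g *\<^sub>R (A1 *v x)"
  by (simp add: pencil_def matrix_vector_mult_add_rdistrib scaleR_matrix_vector_assoc)

lemma pencil_shift:
  "pencil u0 u1 h = pencil u0 u1 g + (h - g) *\<^sub>R u1"
  by (simp add: pencil_def scaleR_diff_left)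

lemma pencil_mult_vector_shift:
  fixes A0 A1 :: "real ^ 'n ^ 'n"
  shows "pencil A0 A1 h *v x = pencil A0 A1 g *v x + (h - g) *\<^sub>R (A1 *v x)"
  by (simp add: pencil_mult_vector scaleR_diff_left)

text \<open>Moving from \<open>g\<close> to \<open>h\<close> changes the form by at most |h - g|
  times the spectral norm of \<open>A1\<close>, so half the constant survives nearby. This bounds
  the inverses uniformly near \<open>g\<close>.\<close>

lemma eventually_coercive_pencil:
  fixes A0 A1 :: "real ^ 'n ^ 'n"
  assumes "0 < \<mu>" and "\<And>x. \<mu> * (norm x)\<^sup>2 \<le> x \<bullet> (pencil A0 A1 g *v x)"
  shows "\<forall>\<^sub>F h in at g. \<forall>x. \<mu> / 2 * (norm x)\<^sup>2 \<le> x \<bullet> (pencil A0 A1 h *v x)"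
proof -
  have "((\<lambda>h. \<bar>h - g\<bar> * spectral_norm A1) \<longlongrightarrow> \<bar>g - g\<bar> * spectral_norm A1) (at g)"
    by (intro tendsto_intros)
  then have "\<forall>\<^sub>F h in at g. \<bar>h - g\<bar> * spectral_norm A1 < \<mu> / 2"
    using assms(1) by (auto dest: order_tendstoD(2)[where a = "\<mu> / 2"])
  then show ?thesis
  proof eventually_elim
    case (elim h)
    show ?case
    proof
      fix x :: "real ^ 'n"
      have "\<bar>(h - g) * (x \<bullet> (A1 *v x))\<bar> \<le> \<bar>h - g\<bar> * (spectral_norm A1 * (norm x)\<^sup>2)"
        unfolding abs_mult by (intro mult_left_mono abs_quadratic_form_le_spectral_norm) auto
      also have "\<dots> \<le> \<mu> / 2 * (norm x)\<^sup>2"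
        unfolding mult.assoc[symmetric] using elim by (intro mult_right_mono) auto
      finally show "\<mu> / 2 * (norm x)\<^sup>2 \<le> x \<bullet> (pencil A0 A1 h *v x)"
        using assms(2)[of x]
        by (simp add: pencil_mult_vector_shift[where g = g and h = h] inner_add_right abs_le_iff)
    qed
  qed
qed

lemma tendsto_inv_pencil_mult_vector:
  fixes A0 A1 :: "real ^ 'n ^ 'n"
  assumes "0 < \<mu>" and "\<And>x. \<mu> * (norm x)\<^sup>2 \<le> x \<bullet> (pencil A0 A1 g *v x)"
  shows "((\<lambda>h. matrix_inv (pencil A0 A1 h) *v v) \<longlongrightarrow> matrix_inv (pencil A0 A1 g) *v v) (at g)"
proof -
  define u where "u = matrix_inv (pencil A0 A1 g) *v v"
  have u: "pencil A0 A1 g *v u = v"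
    unfolding u_def by (rule invertible_mult_inv_vector[OF coercive_imp_invertible[OF assms]])
  have "\<forall>\<^sub>F h in at g. norm (matrix_inv (pencil A0 A1 h) *v v - u)
      \<le> \<bar>h - g\<bar> * norm (A1 *v u) / (\<mu> / 2)"
    using eventually_coercive_pencil[OF assms]
  proof eventually_elim
    case (elim h)
    let ?A = "pencil A0 A1 h"
    have inv: "invertible ?A"
      using elim assms(1) by (intro coercive_imp_invertible[of "\<mu> / 2"]) auto
    \<comment> \<open>Applying the inverse at \<open>h\<close> to this gives the resolvent identity,
      whose right side is O(|h - g|) by the uniform bound 2/\<mu> on that inverse.\<close>
    have "v = ?A *v u - (h - g) *\<^sub>R (A1 *v u)"
      using u by (simp add: pencil_mult_vector_shift[where g = g and h = h])
    then have "matrix_inv ?A *v v - u = - (matrix_inv ?A *v ((h - g) *\<^sub>R (A1 *v u)))"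
      using invertible_inv_mult_vector[OF inv, of u] by (simp add: matrix_vector_mult_diff_distrib)
    then show ?case
      using norm_coercive_inv_le[of "\<mu> / 2" ?A "(h - g) *\<^sub>R (A1 *v u)"] elim assms(1) by simp
  qed
  moreover have "((\<lambda>h. \<bar>h - g\<bar> * norm (A1 *v u) / (\<mu> / 2)) \<longlongrightarrow> 0) (at g)"
    using assms(1) by (auto intro!: tendsto_eq_intros)
  ultimately have "((\<lambda>h. matrix_inv (pencil A0 A1 h) *v v - u) \<longlongrightarrow> 0) (at g)"
    by (rule Lim_null_comparison)
  then show ?thesis
    unfolding u_def by (rule LIM_zero_cancel)
qed

section \<open>The derivative of \<open>nu\<close> and the residual w\<close>

text \<open>The expansion is exact, so difference quotients of \<open>nu\<close> can be computed in
  closed form before passing to the limit.\<close>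

lemma quad_diff:
  fixes A :: "real ^ 'n ^ 'n"
  assumes "transpose A = A"
  shows "quad A b c (x + h) - quad A b c x = (2 *\<^sub>R (A *v x + b) + A *v h) \<bullet> h"
proof -
  have "x \<bullet> (A *v h) = h \<bullet> (A *v x)"
    using assms by (metis dot_lmul_matrix inner_commute transpose_matrix_vector)
  then show ?thesis
    by (simp add: quad_def matrix_vector_right_distrib inner_add_left inner_add_right
        inner_commute algebra_simps)
qed

text \<open>The point x(g) solves the system at \<open>h\<close> up to the error (h - g) w, with w =
  A1 x(g) + b1; the inverse at \<open>h\<close> is then applied. The formula serves twice: for
  \<open>h\<close> tending to \<open>g\<close> in the derivative, and for the fixed reference
  parameter in the bound on w.\<close>

lemma crit_pt_diff:
  fixes A0 A1 :: "real ^ 'n ^ 'n"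
  assumes "invertible (pencil A0 A1 g)" and "invertible (pencil A0 A1 h)"
  shows "crit_pt A0 A1 b0 b1 h - crit_pt A0 A1 b0 b1 g
    = - ((h - g) *\<^sub>R (matrix_inv (pencil A0 A1 h) *v (A1 *v crit_pt A0 A1 b0 b1 g + b1)))"
proof -
  define x where "x = crit_pt A0 A1 b0 b1 g"
  have "pencil A0 A1 g *v x = - pencil b0 b1 g"
    using invertible_mult_inv_vector[OF assms(1)]
    by (simp add: x_def crit_pt_def matrix_vector_mult_minus)
  then have *: "pencil A0 A1 h *v x = (h - g) *\<^sub>R (A1 *v x + b1) - pencil b0 b1 h"
    by (simp add: pencil_mult_vector_shift[where g = g and h = h]
        pencil_shift[where g = g and h = h and ?u0.0 = b0] scaleR_add_right)
  have "x = matrix_inv (pencil A0 A1 h) *v (pencil A0 A1 h *v x)"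
    using invertible_inv_mult_vector[OF assms(2)] by simp
  also have "\<dots> = (h - g) *\<^sub>R (matrix_inv (pencil A0 A1 h) *v (A1 *v x + b1))
      + crit_pt A0 A1 b0 b1 h"
    unfolding * by (simp add: crit_pt_def matrix_vector_mult_diff_distrib matrix_vector_mult_scaleR)
  finally show ?thesis
    unfolding x_def by (metis add_diff_cancel_right' minus_diff_eq)
qed

lemma has_field_derivative_nu:
  fixes A0 A1 :: "real ^ 'n ^ 'n"
  assumes sym: "transpose A1 = A1"
    and pos: "0 < \<mu>" and coer: "\<And>x. \<mu> * (norm x)\<^sup>2 \<le> x \<bullet> (pencil A0 A1 g *v x)"
    and w: "w = A1 *v crit_pt A0 A1 b0 b1 g + b1"
  shows "(nu A0 A1 b0 b1 c1 has_field_derivative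
      - 2 * (w \<bullet> (matrix_inv (pencil A0 A1 g) *v w))) (at g)"
proof -
  let ?x = "crit_pt A0 A1 b0 b1"
  define u where "u h = matrix_inv (pencil A0 A1 h) *v w" for h
  have u: "(u \<longlongrightarrow> u g) (at g)"
    unfolding u_def by (rule tendsto_inv_pencil_mult_vector[OF pos coer])
  \<comment> \<open>This expression equals the difference quotient for \<open>h\<close> near but
    different from \<open>g\<close>. Its limit needs only continuity of \<open>u\<close>, not a
    derivative of the matrix inverse.\<close>
  have "((\<lambda>h. - ((2 *\<^sub>R w - (h - g) *\<^sub>R (A1 *v u h)) \<bullet> u h))
      \<longlongrightarrow> - ((2 *\<^sub>R w - (g - g) *\<^sub>R (A1 *v u g)) \<bullet> u g)) (at g)"
    by (intro tendsto_intros u bounded_linear.tendsto[OF matrix_vector_mul_bounded_linear[of A1]])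
  moreover have "\<forall>\<^sub>F h in at g. - ((2 *\<^sub>R w - (h - g) *\<^sub>R (A1 *v u h)) \<bullet> u h)
      = (nu A0 A1 b0 b1 c1 h - nu A0 A1 b0 b1 c1 g) / (h - g)"
    using eventually_coercive_pencil[OF pos coer] eventually_neq_at_within[of g]
  proof eventually_elim
    case (elim h)
    have "invertible (pencil A0 A1 h)"
      using elim pos by (intro coercive_imp_invertible[of "\<mu> / 2"]) auto
    then have "?x h = ?x g + - ((h - g) *\<^sub>R u h)"
      using crit_pt_diff[OF coercive_imp_invertible[OF pos coer]]
      by (simp add: u_def w algebra_simps)
    then have "nu A0 A1 b0 b1 c1 h - nu A0 A1 b0 b1 c1 g
        = (2 *\<^sub>R w + A1 *v (- ((h - g) *\<^sub>R u h))) \<bullet> (- ((h - g) *\<^sub>R u h))"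
      unfolding nu_def w using quad_diff[OF sym] by presburger
    also have "A1 *v (- ((h - g) *\<^sub>R u h)) = - ((h - g) *\<^sub>R (A1 *v u h))"
      by (simp add: matrix_vector_mult_minus matrix_vector_mult_scaleR)
    finally show ?case
      using elim by simp
  qed
  ultimately have "((\<lambda>h. (nu A0 A1 b0 b1 c1 h - nu A0 A1 b0 b1 c1 g) / (h - g))
      \<longlongrightarrow> - ((2 *\<^sub>R w - (g - g) *\<^sub>R (A1 *v u g)) \<bullet> u g)) (at g)"
    by (rule Lim_transform_eventually)
  then show ?thesis
    by (simp add: has_field_derivative_iff u_def)
qed

text \<open>Carries the residual w from \<open>g\<close> to \<open>h\<close>: the left side is the
  residual A1 x(h) + b1 taken at \<open>h\<close>, and x(g) - x(h) is a multiple of the inverse at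
  \<open>h\<close> applied to w.\<close>

lemma crit_pt_residual_identity:
  fixes A0 A1 :: "real ^ 'n ^ 'n"
  assumes "invertible (pencil A0 A1 g)" and "invertible (pencil A0 A1 h)"
    and w: "w = A1 *v crit_pt A0 A1 b0 b1 g + b1"
  shows "A0 *v (matrix_inv (pencil A0 A1 h) *v b1) - A1 *v (matrix_inv (pencil A0 A1 h) *v b0)
    = w - (h - g) *\<^sub>R (A1 *v (matrix_inv (pencil A0 A1 h) *v w))"
proof -
  let ?M = "matrix_inv (pencil A0 A1 h)"
  have "w = A1 *v crit_pt A0 A1 b0 b1 g + b1"
    by (rule w)
  also have "crit_pt A0 A1 b0 b1 g = crit_pt A0 A1 b0 b1 h + (h - g) *\<^sub>R (?M *v w)"
    using crit_pt_diff[OF assms(1,2), of b0 b1] by (simp add: w algebra_simps)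
  also have "A1 *v (crit_pt A0 A1 b0 b1 h + (h - g) *\<^sub>R (?M *v w)) + b1
      = b1 - A1 *v (?M *v pencil b0 b1 h) + (h - g) *\<^sub>R (A1 *v (?M *v w))"
    by (simp add: crit_pt_def matrix_vector_right_distrib matrix_vector_mult_scaleR
        matrix_vector_mult_minus matrix_vector_mult_diff_distrib)
  \<comment> \<open>Expanding b1 as \<open>pencil A0 A1 h *v (?M *v b1)\<close> makes the two terms
    with factor \<open>h\<close> cancel.\<close>
  also have "b1 - A1 *v (?M *v pencil b0 b1 h) = A0 *v (?M *v b1) - A1 *v (?M *v b0)"
    using invertible_mult_inv_vector[OF assms(2), of b1]
    by (simp add: pencil_mult_vector pencil_def[of b0] matrix_vector_right_distrib
        matrix_vector_mult_scaleR algebra_simps)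
  finally show ?thesis
    by (metis add_diff_cancel_right')
qed

section \<open>Boundedness, convexity and interior points of \<open>Gamma_set\<close>\<close>

lemma psd_pencil_Gamma_set:
  "psd (pencil A0 A1 g)" if "g \<in> Gamma_set A0 A1"
  using that by (simp add: Gamma_set_def loewner_ge_def)

text \<open>Testing the form on an eigenvector for \<open>l\<close> gives a function of g that is
  affine with negative slope, so it stays nonnegative only up to a finite g. Boundedness makes the
  \<open>Sup\<close> in \<open>gamma_plus\<close> a genuine upper bound.\<close>

lemma Gamma_set_bdd_above:
  fixes A0 A1 :: "real ^ 'n ^ 'n"
  assumes "l < 0" and "eigenvalue A1 l"
  shows "bdd_above (Gamma_set A0 A1)"
proof -
  obtain v where v: "v \<noteq> 0" "A1 *v v = l *\<^sub>R v"
    using assms(2) by (auto simp: eigenvalue_def)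
  have "g \<le> (v \<bullet> (A0 *v v)) / (- l * (v \<bullet> v))" if "g \<in> Gamma_set A0 A1" for g
  proof -
    have "0 \<le> v \<bullet> (pencil A0 A1 g *v v)"
      using psd_pencil_Gamma_set[OF that] by (simp add: psd_def)
    then have "g * (- l * (v \<bullet> v)) \<le> v \<bullet> (A0 *v v)"
      using v by (simp add: pencil_mult_vector inner_add_right)
    moreover have "0 < - l * (v \<bullet> v)"
      using assms(1) v by (intro mult_pos_pos) auto
    ultimately show ?thesis
      by (simp only: pos_le_divide_eq)
  qed
  then show ?thesis
    by (rule bdd_aboveI)
qed

lemma convex_Gamma_set: "convex (Gamma_set A0 A1)"
proof (rule convexI)
  fix g h u v :: real
  assume gh: "g \<in> Gamma_set A0 A1" "h \<in> Gamma_set A0 A1" and uv: "0 \<le> u" "0 \<le> v" "u + v = 1"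
  have eq: "pencil A0 A1 (u * g + v * h) = u *\<^sub>R pencil A0 A1 g + v *\<^sub>R pencil A0 A1 h"
  proof -
    \<comment> \<open>The pencil is affine in its parameter, so the constant term has to be split
      with the weights.\<close>
    have "A0 = (u + v) *\<^sub>R A0"
      using uv by simp
    then show ?thesis
      by (simp add: pencil_def scaleR_add_left scaleR_add_right)
  qed
  have "psd (u *\<^sub>R pencil A0 A1 g + v *\<^sub>R pencil A0 A1 h)"
    using gh[THEN psd_pencil_Gamma_set] uv
    by (auto simp: psd_def matrix_vector_mult_add_rdistrib inner_add_right transpose_def vec_eq_iff
        simp flip: scaleR_matrix_vector_assoc)
  then show "u *\<^sub>R g + v *\<^sub>R h \<in> Gamma_set A0 A1"
    using gh uv eq by (simp add: Gamma_set_def loewner_ge_def)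
qed

text \<open>Semidefiniteness at g is upgraded to coercivity through (1 + t) A(g) = A(k) + t A(h),
  where A(k) is semidefinite and A(h) is coercive. The 1 in the denominator of \<open>t\<close> also
  covers g = h.\<close>

lemma interior_Gamma_set_coercive:
  fixes A0 A1 :: "real ^ 'n ^ 'n"
  assumes g: "g \<in> interior (Gamma_set A0 A1)"
    and pos: "0 < \<xi>" and coer: "\<And>x. \<xi> * (norm x)\<^sup>2 \<le> x \<bullet> (pencil A0 A1 h *v x)"
  obtains \<mu> where "0 < \<mu>" "\<And>x. \<mu> * (norm x)\<^sup>2 \<le> x \<bullet> (pencil A0 A1 g *v x)"
proof -
  obtain e where e: "0 < e" "cball g e \<subseteq> Gamma_set A0 A1"
    using g by (auto simp: mem_interior_cball)
  \<comment> \<open>\<open>g\<close> lies strictly between \<open>h\<close> and the point \<open>k\<close> of the set beyond it.\<close>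
  define t where "t = e / (1 + \<bar>g - h\<bar>)"
  define k where "k = g + t * (g - h)"
  have t: "0 < t" "t * \<bar>g - h\<bar> \<le> e"
    using e by (auto simp: t_def field_simps)
  then have "k \<in> Gamma_set A0 A1"
    using e(2) by (auto simp: k_def dist_real_def abs_mult)
  show thesis
  proof
    show "0 < t * \<xi> / (1 + t)"
      using t pos by simp
    fix x :: "real ^ 'n"
    have "0 \<le> x \<bullet> (pencil A0 A1 k *v x)"
      using psd_pencil_Gamma_set[OF \<open>k \<in> _\<close>] by (simp add: psd_def)
    moreover have "(1 + t) * (x \<bullet> (pencil A0 A1 g *v x))
        = x \<bullet> (pencil A0 A1 k *v x) + t * (x \<bullet> (pencil A0 A1 h *v x))"
      by (simp add: pencil_mult_vector inner_add_right k_def algebra_simps)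
    moreover have "t * (\<xi> * (norm x)\<^sup>2) \<le> t * (x \<bullet> (pencil A0 A1 h *v x))"
      using coer t by (intro mult_left_mono) auto
    ultimately have "t * (\<xi> * (norm x)\<^sup>2) \<le> (1 + t) * (x \<bullet> (pencil A0 A1 g *v x))"
      by linarith
    then show "t * \<xi> / (1 + t) * (norm x)\<^sup>2 \<le> x \<bullet> (pencil A0 A1 g *v x)"
      using t by (simp add: field_simps)
  qed
qed

section \<open>Sublevel sets of functions that decrease at a definite rate\<close>

lemma deriv_le_neg_imp_diff_le:
  fixes f :: "real \<Rightarrow> real"
  assumes "is_interval I" and "a \<in> I" and "b \<in> I" and "a \<le> b"
    and deriv: "\<And>x. x \<in> I \<Longrightarrow> f field_differentiable (at x) \<and> deriv f x \<le> - m"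
  shows "f b - f a \<le> - m * (b - a)"
proof (cases "a = b")
  case False
  then have "a < b"
    using assms(4) by simp
  moreover have "(f has_real_derivative deriv f x) (at x)" if "a \<le> x" "x \<le> b" for x
    using deriv[of x] mem_is_interval_1_I[OF assms(1-3) that]
    by (simp add: field_differentiable_derivI)
  ultimately obtain z where z: "a < z" "z < b" "f b - f a = (b - a) * deriv f z"
    using MVT2[of a b f "deriv f"] by blast
  moreover have "deriv f z \<le> - m"
    using deriv mem_is_interval_1_I[OF assms(1-3)] z by simp
  ultimately show ?thesis
    using \<open>a < b\<close> by (metis diff_gt_0_iff_gt mult.commute mult_le_cancel_left_pos)
qed simp

text \<open>Between two points of \<open>S\<close> the function drops by at least m times their
  distance, yet by at most 2 r; monotonicity gives the interval. Boundedness is stated separately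
  because \<open>diameter\<close> is informative only for bounded sets.\<close>

lemma sublevel_abs_interval:
  fixes f :: "real \<Rightarrow> real"
  assumes I: "is_interval I" and m: "0 < m" and r: "0 \<le> r"
    and deriv: "\<And>x. x \<in> I \<Longrightarrow> f field_differentiable (at x) \<and> deriv f x \<le> - m"
  defines "S \<equiv> {x \<in> I. \<bar>f x\<bar> \<le> r}"
  shows "is_interval S \<and> bounded S \<and> diameter S \<le> 2 * r / m"
proof -
  note diff = deriv_le_neg_imp_diff_le[OF I _ _ _ deriv]
  have mono: "f b \<le> f a" if "a \<in> I" "b \<in> I" "a \<le> b" for a b
  proof -
    have "0 \<le> m * (b - a)"
      using m that by simp
    with diff[OF that] show ?thesis
      by simp
  qed
  have "is_interval S"
    unfolding is_interval_1
  proof (intro ballI allI impI)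
    fix a b x
    assume ab: "a \<in> S" "b \<in> S" and x: "a \<le> x \<and> x \<le> b"
    then have "x \<in> I"
      using mem_is_interval_1_I[OF I] by (auto simp: S_def)
    moreover from this have "f b \<le> f x" "f x \<le> f a"
      using ab x by (auto intro!: mono simp: S_def)
    ultimately show "x \<in> S"
      using ab by (auto simp: S_def)
  qed
  have le: "b - a \<le> 2 * r / m" if "a \<in> S" "b \<in> S" "a \<le> b" for a b
  proof -
    have "m * (b - a) \<le> f a - f b"
      using diff[of a b] that by (simp add: S_def)
    also have "\<dots> \<le> 2 * r"
      using that by (auto simp: S_def abs_le_iff)
    finally show ?thesis
      using m by (simp add: field_simps)
  qed
  have dist: "dist a b \<le> 2 * r / m" if "a \<in> S" "b \<in> S" for a b
    using le[of a b] le[of b a] that by (cases "a \<le> b") (auto simp: dist_real_def)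
  have "bounded S"
    unfolding bounded_def using dist by blast
  moreover have "diameter S \<le> 2 * r / m"
    \<comment> \<open>The signs of \<open>m\<close> and \<open>r\<close> make the bound nonnegative,
      which settles the case of empty \<open>S\<close>.\<close>
    using dist m r by (intro diameter_le) (auto simp: dist_norm)
  ultimately show ?thesis
    using \<open>is_interval S\<close> by blast
qed

theorem lemma7:
  fixes A0 A1 :: "real ^ 'n ^ 'n" and b0 b1 :: "real ^ 'n" and c0 c1 :: real
    and \<xi> \<zeta> \<gamma>h \<epsilon> \<delta> :: real
  assumes "transpose A0 = A0" and "transpose A1 = A1"
    and "\<exists>l<0. eigenvalue A0 l" and "\<exists>l<0. eigenvalue A1 l"
    and "spectral_norm A0 \<le> 1" and "norm b0 \<le> 1" and "\<bar>c0\<bar> \<le> 1"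
    and "spectral_norm A1 \<le> 1" and "norm b1 \<le> 1" and "\<bar>c1\<bar> \<le> 1"
    and "0 \<le> \<gamma>h" and "0 < \<epsilon>" and "\<epsilon> < 1"
    and "gamma_plus A0 A1 \<le> \<zeta>"
    and "loewner_ge (pencil A0 A1 \<gamma>h) (\<xi> *\<^sub>R mat 1)"
    and "0 < \<xi>" and "\<xi> \<le> 1" and "1 \<le> \<zeta>"
    and "\<delta> = norm (A0 *v (matrix_inv (pencil A0 A1 \<gamma>h) *v b1)
                   - A1 *v (matrix_inv (pencil A0 A1 \<gamma>h) *v b0))"
    and "0 < \<delta>"
  shows "(\<forall>\<gamma> \<in> interior (Gamma_set A0 A1).
            nu A0 A1 b0 b1 c1 field_differentiable (at \<gamma>) \<and>
            deriv (nu A0 A1 b0 b1 c1) \<gamma> \<le> - (\<delta>\<^sup>2 * \<xi>\<^sup>2 / (4 * \<zeta> ^ 3))) \<and>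
         (let S = {\<gamma> \<in> interior (Gamma_set A0 A1). \<bar>nu A0 A1 b0 b1 c1 \<gamma>\<bar> \<le> \<epsilon> / (2 * \<zeta>)}
          in is_interval S \<and> bounded S \<and>
             diameter S \<le> 4 * \<epsilon> * \<zeta>\<^sup>2 / (\<delta>\<^sup>2 * \<xi>\<^sup>2))"
proof -
  note sym = assms(2) and neg = assms(4) and norm0 = assms(5) and norm1 = assms(8)
    and gh0 = assms(11) and eps = assms(12) and gplus = assms(14) and loew = assms(15)
    and xi = assms(16,17) and zeta = assms(18) and delta = assms(19,20)
  let ?A = "pencil A0 A1" and ?\<nu> = "nu A0 A1 b0 b1 c1" and ?I = "interior (Gamma_set A0 A1)"
  define m where "m = \<delta>\<^sup>2 * \<xi>\<^sup>2 / (4 * \<zeta> ^ 3)"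
  have form: "x \<bullet> (A *v x) \<le> (norm x)\<^sup>2" if "spectral_norm A \<le> 1" for A and x :: "real ^ 'n"
    using abs_quadratic_form_le_spectral_norm[of x A] mult_right_mono[OF that, of "(norm x)\<^sup>2"]
    by simp
  have coer: "\<xi> * (norm x)\<^sup>2 \<le> x \<bullet> (?A \<gamma>h *v x)" for x
    using loew by (simp add: loewner_ge_def psd_def matrix_vector_mult_diff_rdistrib
        inner_diff_right power2_norm_eq_inner flip: scaleR_matrix_vector_assoc)
  note invh = coercive_imp_invertible[OF xi(1) coer]
  \<comment> \<open>Membership of \<open>\<gamma>h\<close> in \<open>Gamma_set\<close> is needed for
    \<open>\<gamma>h\<close> \<le> \<zeta>, hence for |\<open>\<gamma>h\<close> - g| \<le> \<zeta>
    below.\<close>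
  have "transpose (?A \<gamma>h) = ?A \<gamma>h"
    using assms(1,2) by (simp add: pencil_def transpose_def vec_eq_iff)
  moreover have "0 \<le> x \<bullet> (?A \<gamma>h *v x)" for x
    using coer[of x] xi by (smt (verit) mult_nonneg_nonneg zero_le_power2)
  ultimately have gh: "\<gamma>h \<in> Gamma_set A0 A1"
    using gh0 by (simp add: Gamma_set_def loewner_ge_def psd_def)
  have le_zeta: "g \<le> \<zeta>" if "g \<in> Gamma_set A0 A1" for g
    using neg gplus cSup_upper[OF that] Gamma_set_bdd_above unfolding gamma_plus_def by force

  have deriv: "?\<nu> field_differentiable (at g) \<and> deriv ?\<nu> g \<le> - m" if g: "g \<in> ?I" for g
  proof -
    have gG: "g \<in> Gamma_set A0 A1"
      using g interior_subset by blast
    have g0: "0 \<le> g" and gz: "g \<le> \<zeta>" and ghz: "\<gamma>h \<le> \<zeta>"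
      using gG gh le_zeta by (auto simp: Gamma_set_def)
    obtain \<mu> where mu: "0 < \<mu>" "\<And>x. \<mu> * (norm x)\<^sup>2 \<le> x \<bullet> (?A g *v x)"
      using interior_Gamma_set_coercive[OF g xi(1) coer] by blast
    note inv = coercive_imp_invertible[OF mu]
    define w where "w = A1 *v crit_pt A0 A1 b0 b1 g + b1"
    define u where "u = matrix_inv (?A g) *v w"
    have D: "(?\<nu> has_field_derivative - 2 * (w \<bullet> u)) (at g)"
      unfolding u_def by (rule has_field_derivative_nu[OF sym mu w_def])

    \<comment> \<open>The constant comes from 1 + g \<le> 1 + \<zeta> \<le> 2 \<zeta>.\<close>
    have "x \<bullet> (?A g *v x) \<le> (2 * \<zeta>) * (norm x)\<^sup>2" for x
    proof -
      have "x \<bullet> (?A g *v x) \<le> (norm x)\<^sup>2 + g * (norm x)\<^sup>2"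
        using form[OF norm0, of x] form[OF norm1, of x] g0
        by (simp add: pencil_mult_vector inner_add_right add_mono mult_left_mono)
      also have "\<dots> = (1 + g) * (norm x)\<^sup>2"
        by (simp add: algebra_simps)
      also have "\<dots> \<le> (2 * \<zeta>) * (norm x)\<^sup>2"
        using gz zeta by (intro mult_right_mono) auto
      finally show ?thesis .
    qed
    then have "(norm (?A g *v u))\<^sup>2 \<le> 2 * \<zeta> * (u \<bullet> (?A g *v u))"
      using zeta by (intro psd_norm_square_le psd_pencil_Gamma_set gG) auto
    moreover have "?A g *v u = w"
      unfolding u_def by (rule invertible_mult_inv_vector[OF inv])
    ultimately have wu: "(norm w)\<^sup>2 \<le> 2 * \<zeta> * (w \<bullet> u)"
      by (simp add: inner_commute)

    let ?z = "matrix_inv (?A \<gamma>h) *v w"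
    have "norm (A1 *v ?z) \<le> norm ?z"
      using norm_mult_le_spectral_norm[of A1 ?z] mult_right_mono[OF norm1, of "norm ?z"] by simp
    also have "\<dots> \<le> norm w / \<xi>"
      by (rule norm_coercive_inv_le[OF xi(1) coer])
    finally have z: "norm (A1 *v ?z) \<le> norm w / \<xi>" .
    have "\<delta> \<le> norm w + \<bar>\<gamma>h - g\<bar> * norm (A1 *v ?z)"
      unfolding delta(1) crit_pt_residual_identity[OF inv invh w_def]
      by (metis norm_scaleR norm_triangle_ineq4)
    also have "\<dots> \<le> norm w + \<zeta> * (norm w / \<xi>)"
      using z g0 gz gh0 ghz zeta by (intro add_left_mono mult_mono) auto
    \<comment> \<open>Since \<xi> \<le> 1 \<le> \<zeta>, the factor \<zeta> / \<xi> is at least 1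
      and absorbs the lone |w|.\<close>
    also have "\<dots> \<le> \<zeta> * (norm w / \<xi>) + \<zeta> * (norm w / \<xi>)"
    proof -
      have "norm w * \<xi> \<le> norm w * \<zeta>"
        using xi zeta by (intro mult_left_mono) auto
      then show ?thesis
        using xi by (simp add: field_simps)
    qed
    finally have "\<delta> * \<xi> \<le> 2 * \<zeta> * norm w"
      using xi by (simp add: field_simps)
    \<comment> \<open>Squaring contributes 4 \<zeta>^2 and \<open>wu\<close> one more factor 2
      \<zeta>; its 2 is the factor in front of w . u in the derivative, leaving 4 \<zeta>^3 in
      \<open>m\<close>.\<close>
    then have "(\<delta> * \<xi>)\<^sup>2 \<le> (2 * \<zeta> * norm w)\<^sup>2"
      using delta(2) xi by (intro power_mono) auto
    also have "\<dots> = 4 * \<zeta>\<^sup>2 * (norm w)\<^sup>2"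
      by (simp add: power_mult_distrib)
    also have "\<dots> \<le> 4 * \<zeta>\<^sup>2 * (2 * \<zeta> * (w \<bullet> u))"
      using wu by (intro mult_left_mono) auto
    also have "\<dots> = 4 * \<zeta> ^ 3 * (2 * (w \<bullet> u))"
      by (simp add: power2_eq_square power3_eq_cube)
    finally have "m \<le> 2 * (w \<bullet> u)"
      unfolding m_def using zeta by (simp add: pos_divide_le_eq power_mult_distrib mult_ac)
    then show ?thesis
      using D by (auto simp: field_differentiable_def DERIV_imp_deriv)
  qed

  have "0 < m"
    using delta(2) xi zeta by (simp add: m_def)
  moreover have "is_interval ?I"
    using convex_Gamma_set[of A0 A1] by (simp add: is_interval_convex_1 convex_interior)
  moreover have "0 \<le> \<epsilon> / (2 * \<zeta>)"
    using eps zeta by simp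
  \<comment> \<open>The generic bound 2 r / m at r = \<epsilon> / (2 \<zeta>): one \<zeta> of the
    cube in \<open>m\<close> cancels.\<close>
  moreover have "2 * (\<epsilon> / (2 * \<zeta>)) / m = 4 * \<epsilon> * \<zeta>\<^sup>2 / (\<delta>\<^sup>2 * \<xi>\<^sup>2)"
    using delta(2) xi zeta by (simp add: m_def power2_eq_square power3_eq_cube)
  ultimately show ?thesis
    using sublevel_abs_interval[of ?I m "\<epsilon> / (2 * \<zeta>)" ?\<nu>, OF _ _ _ deriv] deriv
    unfolding Let_def m_def[symmetric] by simp
qed

end
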